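(* Let $\gamma(\cdot,t)$, $t\in[0,T)$, be a smooth family of closed embedded convex curves in the plane $\mathbb{R}^2$ evolving by the curve shortening flow $\frac{\partial\gamma}{\partial t}=\kappa\mathbf{N}$, whose initial curve has curvature $\kappa>0$ everywhere. Let $\kappa(s,t)$ denote the curvature of the curve at the point $s$ and time $t$, where $s$ is the arc-length parameter, and let $u(s,t)=\log\kappa(s,t)$. For $\epsilon>0$ define $$h_{\epsilon}(s,t):=u_{ss}+e^{2u}+\left(\frac{1}{2}+\epsilon\right)\frac{1}{t}.$$ Then for every $\epsilon>0$, every time $t\in(0,T)$ and every point $s$ of the curve, $h_{\epsilon}(s,t)\geq 0$.
   Context: A family of closed embedded planar curves is a smooth map $\gamma:\mathbb{R}\times[0,T)\to\mathbb{R}^2$, $(x,t)\mapsto\gamma(x,t)$, such that for each $t$ the map $\gamma(\cdot,t)$ is an immersion ($\gamma_x\neq 0$), is periodic in $x$ with some fixed period, and is injective modulo that period. The arc-length derivative at time $t$ is $\frac{\partial}{\partial s}=\frac{1}{|\gamma_x|}\frac{\partial}{\partial x}$, and the time derivative $\frac{\partial}{\partial t}$ is taken with $x$ held fixed (so $\partial_t$ and $\partial_s$ do not commute: $\partial_t\partial_s=\partial_s\partial_t+\kappa^2\partial_s$). The unit tangent is $\mathbf{T}=\gamma_s$, $\mathbf{N}$ is a continuous choice of unit normal, and the curvature $\kappa$ is defined by $\mathbf{T}_s=\kappa\mathbf{N}$, $\mathbf{N}_s=-\kappa\mathbf{T}$. The curve shortening flow is $\frac{\partial\gamma}{\partial t}=\kappa\mathbf{N}$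 with initial condition $\gamma(\cdot,0)=\gamma_0$. Functions written as functions of $(s,t)$ are functions on the evolving curve, and subscripts $s$, $t$ denote the derivatives $\partial_s$, $\partial_t$ above. Convexity of the initial curve means $\kappa>0$ at time $t=0$ (with $\mathbf{N}$ the inward normal). Under the flow $\kappa_t=\kappa_{ss}+\kappa^3$, and it is known that $\kappa>0$ then holds for all $t\in[0,T)$, so that $u=\log\kappa$ is well defined. *)

theory Defs
  imports "HOL-Analysis.Analysis"
begin

text \<open>
  Families of curves are curried functions \<open>\<gamma> x t\<close> with \<open>x\<close> the curve parameter and \<open>t\<close> the time.
  Only the values at times in \<open>{0..<T}\<close> are meaningful, so time derivatives are taken within
  \<open>{0..<T}\<close>; at \<open>t = 0\<close> they are one-sided.
\<close>

text \<open>
  \<open>C_k\<close> regularity on \<open>\<real> \<times> [0,T)\<close>, up to and including the boundary \<open>t = 0\<close>: all (arbitrarily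
  mixed) partial derivatives of order at most \<open>k\<close> exist and are jointly continuous.
\<close>

primrec C_k_family :: "nat \<Rightarrow> real \<Rightarrow> (real \<Rightarrow> real \<Rightarrow> 'a::real_normed_vector) \<Rightarrow> bool" where
  "C_k_family 0 T f \<longleftrightarrow> continuous_on (UNIV \<times> {0..<T}) (\<lambda>(x, t). f x t)"
| "C_k_family (Suc k) T f \<longleftrightarrow>
     continuous_on (UNIV \<times> {0..<T}) (\<lambda>(x, t). f x t) \<and>
     (\<exists>fx ft.
        (\<forall>x. \<forall>t\<in>{0..<T}.
           ((\<lambda>y. f y t) has_vector_derivative fx x t) (at x) \<and>
           ((\<lambda>\<tau>. f x \<tau>) has_vector_derivative ft x t) (at t within {0..<T})) \<and>
        C_k_family k T fx \<and> C_k_family k T ft)"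

definition smooth_family :: "real \<Rightarrow> (real \<Rightarrow> real \<Rightarrow> 'a::real_normed_vector) \<Rightarrow> bool" where
  "smooth_family T f \<longleftrightarrow> (\<forall>k. C_k_family k T f)"

definition deriv_x :: "(real \<Rightarrow> real \<Rightarrow> 'a::real_normed_vector) \<Rightarrow> real \<Rightarrow> real \<Rightarrow> 'a" where
  "deriv_x f x t = vector_derivative (\<lambda>y. f y t) (at x)"

definition closed_embedded_family :: "real \<Rightarrow> (real \<Rightarrow> real \<Rightarrow> real^2) \<Rightarrow> bool" where
  "closed_embedded_family T \<gamma> \<longleftrightarrow>
     smooth_family T \<gamma> \<and>
     (\<forall>x. \<forall>t\<in>{0..<T}. deriv_x \<gamma> x t \<noteq> 0) \<and>
     (\<exists>P>0. \<forall>t\<in>{0..<T}.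
        (\<forall>x. \<gamma> (x + P) t = \<gamma> x t) \<and>
        (\<forall>x y. \<gamma> x t = \<gamma> y t \<longrightarrow> (\<exists>k::int. x - y = of_int k * P)))"

definition deriv_s ::
    "(real \<Rightarrow> real \<Rightarrow> real^2) \<Rightarrow> (real \<Rightarrow> real \<Rightarrow> 'a::real_normed_vector) \<Rightarrow> real \<Rightarrow> real \<Rightarrow> 'a" where
  "deriv_s \<gamma> f x t = (1 / norm (deriv_x \<gamma> x t)) *\<^sub>R deriv_x f x t"

definition unit_tangent :: "(real \<Rightarrow> real \<Rightarrow> real^2) \<Rightarrow> real \<Rightarrow> real \<Rightarrow> real^2" where
  "unit_tangent \<gamma> = deriv_s \<gamma> \<gamma>"

definition unit_normal_field ::
    "real \<Rightarrow> (real \<Rightarrow> real \<Rightarrow> real^2) \<Rightarrow> (real \<Rightarrow> real \<Rightarrow> real^2) \<Rightarrow> bool" where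
  "unit_normal_field T \<gamma> N \<longleftrightarrow>
     continuous_on (UNIV \<times> {0..<T}) (\<lambda>(x, t). N x t) \<and>
     (\<forall>x. \<forall>t\<in>{0..<T}. norm (N x t) = 1 \<and> N x t \<bullet> unit_tangent \<gamma> x t = 0)"

text \<open>\<open>\<kappa>\<close> is the curvature with respect to the normal \<open>N\<close>: the Frenet equations determine it uniquely.\<close>

definition is_curvature ::
    "real \<Rightarrow> (real \<Rightarrow> real \<Rightarrow> real^2) \<Rightarrow> (real \<Rightarrow> real \<Rightarrow> real^2) \<Rightarrow> (real \<Rightarrow> real \<Rightarrow> real) \<Rightarrow> bool" where
  "is_curvature T \<gamma> N \<kappa> \<longleftrightarrow>
     (\<forall>x. \<forall>t\<in>{0..<T}.
        deriv_s \<gamma> (unit_tangent \<gamma>) x t = \<kappa> x t *\<^sub>R N x t \<and>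
        deriv_s \<gamma> N x t = - (\<kappa> x t *\<^sub>R unit_tangent \<gamma> x t))"

definition curve_shortening_flow ::
    "real \<Rightarrow> (real \<Rightarrow> real \<Rightarrow> real^2) \<Rightarrow> (real \<Rightarrow> real \<Rightarrow> real^2) \<Rightarrow> (real \<Rightarrow> real \<Rightarrow> real) \<Rightarrow> bool" where
  "curve_shortening_flow T \<gamma> N \<kappa> \<longleftrightarrow>
     (\<forall>x. \<forall>t\<in>{0..<T}.
        ((\<lambda>\<tau>. \<gamma> x \<tau>) has_vector_derivative \<kappa> x t *\<^sub>R N x t) (at t within {0..<T}))"

definition inward_at ::
    "(real \<Rightarrow> real \<Rightarrow> real^2) \<Rightarrow> (real \<Rightarrow> real \<Rightarrow> real^2) \<Rightarrow> real \<Rightarrow> bool" where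
  "inward_at \<gamma> N t \<longleftrightarrow>
     (\<forall>x. eventually (\<lambda>r. \<gamma> x t + r *\<^sub>R N x t \<in> inside (range (\<lambda>y. \<gamma> y t))) (at_right 0))"

definition convex_initial_curve ::
    "(real \<Rightarrow> real \<Rightarrow> real^2) \<Rightarrow> (real \<Rightarrow> real \<Rightarrow> real^2) \<Rightarrow> (real \<Rightarrow> real \<Rightarrow> real) \<Rightarrow> bool" where
  "convex_initial_curve \<gamma> N \<kappa> \<longleftrightarrow> inward_at \<gamma> N 0 \<and> (\<forall>x. \<kappa> x 0 > 0)"

definition log_curvature :: "(real \<Rightarrow> real \<Rightarrow> real) \<Rightarrow> real \<Rightarrow> real \<Rightarrow> real" where
  "log_curvature \<kappa> x t = ln (\<kappa> x t)"

definition harnack_h ::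
    "(real \<Rightarrow> real \<Rightarrow> real^2) \<Rightarrow> (real \<Rightarrow> real \<Rightarrow> real) \<Rightarrow> real \<Rightarrow> real \<Rightarrow> real \<Rightarrow> real" where
  "harnack_h \<gamma> \<kappa> \<epsilon> x t =
     deriv_s \<gamma> (deriv_s \<gamma> (log_curvature \<kappa>)) x t
     + exp (2 * log_curvature \<kappa> x t) + (1 / 2 + \<epsilon>) * (1 / t)"

end

theory Submission
  imports Defs
begin

text \<open>
  Along the flow, \<open>\<partial>\<^sub>t\<partial>\<^sub>s = \<partial>\<^sub>s\<partial>\<^sub>t + \<kappa>\<^sup>2\<partial>\<^sub>s\<close> gives \<open>\<kappa>\<^sub>t = \<kappa>\<^sub>s\<^sub>s + \<kappa>\<^sup>3\<close>, and hence \<open>u\<^sub>t = u\<^sub>s\<^sub>s + u\<^sub>s\<^sup>2 + e\<^bsup>2u\<^esup>\<close>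
  for \<open>u = log \<kappa>\<close>. The quantity \<open>F = u\<^sub>s\<^sub>s + e\<^bsup>2u\<^esup>\<close> then satisfies \<open>F\<^sub>t = F\<^sub>s\<^sub>s + 2 u\<^sub>s F\<^sub>s + 2 F\<^sup>2\<close>, and
  the maximum principle compares it with the solution \<open>- 1 / (2 t)\<close> of \<open>y' = 2 y\<^sup>2\<close>. Positivity of
  \<open>\<kappa>\<close> at later times follows from the maximum principle as well.
\<close>

section \<open>Calculus of smooth families\<close>

lemma C_k_family_continuous:
  "C_k_family k T f \<Longrightarrow> continuous_on (UNIV \<times> {0..<T}) (\<lambda>(x, t). f x t)"
  by (cases k) auto

lemma C_k_family_SucI:
  assumes "continuous_on (UNIV \<times> {0..<T}) (\<lambda>(x, t). f x t)"
    and "\<And>x t. t \<in> {0..<T} \<Longrightarrow> ((\<lambda>y. f y t) has_vector_derivative fx x t) (at x)"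
    and "\<And>x t. t \<in> {0..<T} \<Longrightarrow>
      ((\<lambda>\<tau>. f x \<tau>) has_vector_derivative ft x t) (at t within {0..<T})"
    and "C_k_family k T fx" "C_k_family k T ft"
  shows "C_k_family (Suc k) T f"
  unfolding C_k_family.simps by (intro conjI exI[of _ fx] exI[of _ ft] allI ballI assms)

lemma C_k_family_SucE:
  assumes "C_k_family (Suc k) T f"
  obtains fx ft where
    "\<And>x t. t \<in> {0..<T} \<Longrightarrow> ((\<lambda>y. f y t) has_vector_derivative fx x t) (at x)"
    "\<And>x t. t \<in> {0..<T} \<Longrightarrow>
      ((\<lambda>\<tau>. f x \<tau>) has_vector_derivative ft x t) (at t within {0..<T})"
    "C_k_family k T fx" "C_k_family k T ft"
  using assms unfolding C_k_family.simps by blast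

text \<open>The spatial derivative is taken at a fixed time and the time derivative within
  \<open>{0..<T}\<close>, so neither sees values at other times. Identities that hold only while the
  flow exists can therefore transport regularity.\<close>

lemma C_k_family_cong:
  assumes "C_k_family k T f" and "\<And>x t. t \<in> {0..<T} \<Longrightarrow> g x t = f x t"
  shows "C_k_family k T g"
proof -
  have cont: "continuous_on (UNIV \<times> {0..<T}) (\<lambda>(x, t). g x t)"
    by (rule continuous_on_eq[OF C_k_family_continuous[OF assms(1)]]) (use assms(2) in auto)
  show ?thesis
  proof (cases k)
    case 0
    with cont show ?thesis by simp
  next
    case (Suc j)
    from assms(1)[unfolded Suc] show ?thesis
    proof (rule C_k_family_SucE)
      fix fx ft
      assume fx: "\<And>x t. t \<in> {0..<T} \<Longrightarrow> ((\<lambda>y. f y t) has_vector_derivative fx x t) (at x)"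
        and ft: "\<And>x t. t \<in> {0..<T} \<Longrightarrow>
          ((\<lambda>\<tau>. f x \<tau>) has_vector_derivative ft x t) (at t within {0..<T})"
        and C: "C_k_family j T fx" "C_k_family j T ft"
      show "C_k_family k T g"
        unfolding Suc
      proof (rule C_k_family_SucI[OF cont _ _ C])
        fix x t assume t: "t \<in> {0..<T}"
        then show "((\<lambda>y. g y t) has_vector_derivative fx x t) (at x)"
          using fx by (simp add: assms(2))
        show "((\<lambda>\<tau>. g x \<tau>) has_vector_derivative ft x t) (at t within {0..<T})"
          by (rule has_vector_derivative_transform[OF t _ ft[OF t]]) (simp add: assms(2))
      qed
    qed
  qed
qed

section \<open>Canonical partial derivatives\<close>

definition deriv_t ::
    "real \<Rightarrow> (real \<Rightarrow> real \<Rightarrow> 'a::real_normed_vector) \<Rightarrow> real \<Rightarrow> real \<Rightarrow> 'a" where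
  "deriv_t T f x t = vector_derivative (f x) (at t within {0..<T})"

lemma deriv_t_eq:
  assumes "t \<in> {0..<T}" "((\<lambda>\<tau>. f x \<tau>) has_vector_derivative d) (at t within {0..<T})"
  shows "deriv_t T f x t = d"
proof -
  \<comment> \<open>The later times \<open>{t<..<T}\<close> accumulate at t, also when t = 0; hence
    a derivative within \<open>{0..<T}\<close> is unique.\<close>
  have "t islimpt {0..<T}"
    using assms(1) islimpt_subset[of t "{t<..<T}" "{0..<T}"] by (force simp: islimpt_greaterThanLessThan1)
  then show ?thesis
    unfolding deriv_t_def using assms(2) trivial_limit_within vector_derivative_within by blast
qed

lemma deriv_x_eq:
  "((\<lambda>y. f y t) has_vector_derivative d) (at x) \<Longrightarrow> deriv_x f x t = d"
  unfolding deriv_x_def by (rule vector_derivative_at)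

text \<open>By uniqueness of derivatives, the existentially quantified \<open>fx\<close> and
  \<open>ft\<close> agree with \<open>deriv_x f\<close> and \<open>deriv_t T f\<close> at all
  relevant times. All later calculus can then use these two fixed operators instead of
  witnesses.\<close>

lemma C_k_family_SucD:
  assumes "C_k_family (Suc k) T f"
  shows "t \<in> {0..<T} \<Longrightarrow> ((\<lambda>y. f y t) has_vector_derivative deriv_x f x t) (at x)"
    and "t \<in> {0..<T} \<Longrightarrow>
      ((\<lambda>\<tau>. f x \<tau>) has_vector_derivative deriv_t T f x t) (at t within {0..<T})"
    and "C_k_family k T (deriv_x f)" and "C_k_family k T (deriv_t T f)"
proof -
  from assms obtain fx ft where fx: "\<forall>x. \<forall>t\<in>{0..<T}.
           ((\<lambda>y. f y t) has_vector_derivative fx x t) (at x)"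
    and ft: "\<forall>x. \<forall>t\<in>{0..<T}.
           ((\<lambda>\<tau>. f x \<tau>) has_vector_derivative ft x t) (at t within {0..<T})"
    and C: "C_k_family k T fx" "C_k_family k T ft"
    unfolding C_k_family.simps by blast
  have x: "deriv_x f x t = fx x t" if "t \<in> {0..<T}" for x t
    using deriv_x_eq fx that by blast
  have t: "deriv_t T f x t = ft x t" if "t \<in> {0..<T}" for x t
    using deriv_t_eq ft that by blast
  show "t \<in> {0..<T} \<Longrightarrow> ((\<lambda>y. f y t) has_vector_derivative deriv_x f x t) (at x)"
    using fx x by simp
  show "t \<in> {0..<T} \<Longrightarrow>
      ((\<lambda>\<tau>. f x \<tau>) has_vector_derivative deriv_t T f x t) (at t within {0..<T})"
    using ft t by simp
  show "C_k_family k T (deriv_x f)" by (rule C_k_family_cong[OF C(1) x])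
  show "C_k_family k T (deriv_t T f)" by (rule C_k_family_cong[OF C(2) t])
qed

lemma C_k_family_Suc_imp: "C_k_family (Suc k) T f \<Longrightarrow> C_k_family k T f"
proof (induction k arbitrary: f)
  case 0
  then show ?case by simp
next
  case (Suc k)
  from C_k_family_SucD[OF Suc.prems] show ?case
    by (intro C_k_family_SucI[OF C_k_family_continuous[OF Suc.prems]] Suc.IH)
qed

section \<open>Closure of C_k regularity under algebraic operations and composition\<close>

lemma C_k_family_const: "C_k_family k T (\<lambda>x t. c)"
proof (induction k arbitrary: c)
  case (Suc k)
  show ?case
    by (rule C_k_family_SucI[where fx = "\<lambda>x t. 0" and ft = "\<lambda>x t. 0"]) (auto intro: Suc)
qed simp

lemma C_k_family_add:
  "C_k_family k T f \<Longrightarrow> C_k_family k T g \<Longrightarrow> C_k_family k T (\<lambda>x t. f x t + g x t)"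
proof (induction k arbitrary: f g)
  case 0
  then show ?case by (auto simp: case_prod_unfold intro: continuous_on_add)
next
  case (Suc k)
  have cont: "continuous_on (UNIV \<times> {0..<T}) (\<lambda>(x, t). f x t + g x t)"
    using Suc.prems[THEN C_k_family_continuous]
    by (auto simp: case_prod_unfold intro: continuous_on_add)
  show ?case
    by (intro C_k_family_SucI[OF cont,
          where fx = "\<lambda>x t. deriv_x f x t + deriv_x g x t"
            and ft = "\<lambda>x t. deriv_t T f x t + deriv_t T g x t"]
        has_vector_derivative_add Suc.IH C_k_family_SucD[OF Suc.prems(1)]
        C_k_family_SucD[OF Suc.prems(2)])
qed

text \<open>One product rule serves multiplication, scaling and inner product at once. Each summand
  of the derivative pairs an undifferentiated factor with a differentiated one, so the induction
  also needs the factors themselves at the lower order.\<close>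

lemma C_k_family_bilinear:
  assumes h: "bounded_bilinear h"
  shows "C_k_family k T f \<Longrightarrow> C_k_family k T g \<Longrightarrow> C_k_family k T (\<lambda>x t. h (f x t) (g x t))"
proof (induction k arbitrary: f g)
  case 0
  then show ?case
    by (auto simp: case_prod_unfold intro: bounded_bilinear.continuous_on[OF h])
next
  case (Suc k)
  have cont: "continuous_on (UNIV \<times> {0..<T}) (\<lambda>(x, t). h (f x t) (g x t))"
    using Suc.prems[THEN C_k_family_continuous]
    by (auto simp: case_prod_unfold intro: bounded_bilinear.continuous_on[OF h])
  note f = C_k_family_SucD[OF Suc.prems(1)] and g = C_k_family_SucD[OF Suc.prems(2)]
  show ?case
    by (intro C_k_family_SucI[OF cont,
          where fx = "\<lambda>x t. h (f x t) (deriv_x g x t) + h (deriv_x f x t) (g x t)"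
            and ft = "\<lambda>x t. h (f x t) (deriv_t T g x t) + h (deriv_t T f x t) (g x t)"]
        bounded_bilinear.has_vector_derivative[OF h] C_k_family_add Suc.IH f g
        Suc.prems[THEN C_k_family_Suc_imp])
qed

lemma C_k_family_linear:
  assumes h: "bounded_linear h" and f: "C_k_family k T f"
  shows "C_k_family k T (\<lambda>x t. h (f x t))"
proof -
  \<comment> \<open>A linear map is the bilinear map \<open>c *\<^sub>R h y\<close> with c frozen at
    1.\<close>
  have "bounded_bilinear (\<lambda>(c::real) y. c *\<^sub>R h y)"
    by (rule bounded_bilinear.comp[OF bounded_bilinear_scaleR bounded_linear_ident h])
  from C_k_family_bilinear[OF this C_k_family_const[of _ _ 1] f] show ?thesis by simp
qed

text \<open>Regularity is asked of the composite \<open>g' (f x t)\<close> rather than of g'. This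
  suits outer functions whose derivative is expressible through the function itself or through one
  already treated: inverse, sqrt and exp then follow by induction on k, and ln follows from
  inverse.\<close>

lemma C_k_family_chain:
  fixes f :: "real \<Rightarrow> real \<Rightarrow> real"
  assumes "C_k_family (Suc k) T f"
    and g: "\<And>x t. t \<in> {0..<T} \<Longrightarrow> (g has_real_derivative g' (f x t)) (at (f x t))"
    and "C_k_family k T (\<lambda>x t. g' (f x t))"
  shows "C_k_family (Suc k) T (\<lambda>x t. g (f x t))"
proof -
  note cont = C_k_family_continuous[OF assms(1)]
  have "continuous_on ((\<lambda>(x, t). f x t) ` (UNIV \<times> {0..<T})) g"
    by (intro continuous_at_imp_continuous_on) (auto intro!: DERIV_isCont g)
  from continuous_on_compose[OF cont this]
  have cont': "continuous_on (UNIV \<times> {0..<T}) (\<lambda>(x, t). g (f x t))"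
    by (simp add: o_def case_prod_unfold)
  note f = C_k_family_SucD[OF assms(1)]
  show ?thesis
  proof (rule C_k_family_SucI[OF cont'])
    fix x t assume t: "t \<in> {0..<T}"
    show "((\<lambda>y. g (f y t)) has_vector_derivative g' (f x t) * deriv_x f x t) (at x)"
      using f(1)[OF t, of x] unfolding has_real_derivative_iff_has_vector_derivative[symmetric]
      by (rule DERIV_chain2[where f = g, rotated]) (rule g[OF t])
    show "((\<lambda>\<tau>. g (f x \<tau>)) has_vector_derivative g' (f x t) * deriv_t T f x t) (at t within {0..<T})"
      using f(2)[OF t, of x] unfolding has_real_derivative_iff_has_vector_derivative[symmetric]
      by (rule DERIV_chain2[where f = g, rotated]) (rule g[OF t])
  qed (intro C_k_family_bilinear[OF bounded_bilinear_mult] assms(3) f)+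
qed

lemma C_k_family_inverse:
  fixes f :: "real \<Rightarrow> real \<Rightarrow> real"
  assumes "C_k_family k T f" and nz: "\<And>x t. t \<in> {0..<T} \<Longrightarrow> f x t \<noteq> 0"
  shows "C_k_family k T (\<lambda>x t. inverse (f x t))"
  using assms(1)
proof (induction k)
  case 0
  then show ?case
    using nz by (auto simp: case_prod_unfold intro!: continuous_on_inverse)
next
  case (Suc k)
  show ?case
  proof (rule C_k_family_chain[OF Suc.prems, where g = inverse and g' = "\<lambda>y. - (inverse y * inverse y)"])
    fix x t assume "t \<in> {0..<T}"
    from DERIV_inverse[OF nz[OF this]]
    show "(inverse has_real_derivative - (inverse (f x t) * inverse (f x t))) (at (f x t))"
      by (simp add: numeral_2_eq_2)
  next
    show "C_k_family k T (\<lambda>x t. - (inverse (f x t) * inverse (f x t)))"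
      by (intro C_k_family_linear[OF bounded_linear_minus[OF bounded_linear_ident]]
          C_k_family_bilinear[OF bounded_bilinear_mult]
          Suc.IH[OF C_k_family_Suc_imp[OF Suc.prems]])
  qed
qed

lemma C_k_family_sqrt:
  fixes f :: "real \<Rightarrow> real \<Rightarrow> real"
  assumes "C_k_family k T f" and pos: "\<And>x t. t \<in> {0..<T} \<Longrightarrow> f x t > 0"
  shows "C_k_family k T (\<lambda>x t. sqrt (f x t))"
  using assms(1)
proof (induction k)
  case 0
  then show ?case
    by (auto simp: case_prod_unfold intro!: continuous_on_real_sqrt)
next
  case (Suc k)
  have nz: "sqrt (f x t) \<noteq> 0" if "t \<in> {0..<T}" for x t
    using pos[OF that, of x] by simp
  show ?case
  proof (rule C_k_family_chain[OF Suc.prems, where g = sqrt and g' = "\<lambda>y. inverse (sqrt y) / 2"])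
    fix x t assume "t \<in> {0..<T}"
    from DERIV_real_sqrt[OF pos[OF this]]
    show "(sqrt has_real_derivative inverse (sqrt (f x t)) / 2) (at (f x t))" by simp
  next
    show "C_k_family k T (\<lambda>x t. inverse (sqrt (f x t)) / 2)"
      by (intro C_k_family_linear[OF bounded_linear_divide] C_k_family_inverse
          Suc.IH[OF C_k_family_Suc_imp[OF Suc.prems]] nz)
  qed
qed

lemma C_k_family_ln:
  fixes f :: "real \<Rightarrow> real \<Rightarrow> real"
  assumes "C_k_family k T f" and pos: "\<And>x t. t \<in> {0..<T} \<Longrightarrow> f x t > 0"
  shows "C_k_family k T (\<lambda>x t. ln (f x t))"
proof (cases k)
  case 0
  have "f x t \<noteq> 0" if "t \<in> {0..<T}" for x t
    using pos[OF that, of x] by simp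
  with assms(1) 0 show ?thesis
    by (auto simp: case_prod_unfold intro!: continuous_on_ln)
next
  case (Suc j)
  have nz: "f x t \<noteq> 0" if "t \<in> {0..<T}" for x t
    using pos[OF that, of x] by simp
  show ?thesis
    unfolding Suc
  proof (rule C_k_family_chain[where f = f and g = ln and g' = inverse])
    show "C_k_family (Suc j) T f" using assms(1) by (simp only: Suc)
    then show "C_k_family j T (\<lambda>x t. inverse (f x t))"
      by (rule C_k_family_inverse[OF C_k_family_Suc_imp nz])
    show "(ln has_real_derivative inverse (f x t)) (at (f x t))" if "t \<in> {0..<T}" for x t
      by (rule DERIV_ln[OF pos[OF that]])
  qed
qed

lemma C_k_family_exp:
  fixes f :: "real \<Rightarrow> real \<Rightarrow> real"
  assumes "C_k_family k T f"
  shows "C_k_family k T (\<lambda>x t. exp (f x t))"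
  using assms
proof (induction k)
  case 0
  then show ?case
    by (auto simp: case_prod_unfold intro!: continuous_on_exp)
next
  case (Suc k)
  show ?case
    by (rule C_k_family_chain[OF Suc.prems DERIV_exp Suc.IH[OF C_k_family_Suc_imp[OF Suc.prems]]])
qed

section \<open>The same rules for smooth families\<close>

lemma smooth_family_has_deriv_x:
  "smooth_family T f \<Longrightarrow> t \<in> {0..<T} \<Longrightarrow>
    ((\<lambda>y. f y t) has_vector_derivative deriv_x f x t) (at x)"
  unfolding smooth_family_def using C_k_family_SucD(1) by blast

lemma smooth_family_has_deriv_t:
  "smooth_family T f \<Longrightarrow> t \<in> {0..<T} \<Longrightarrow>
    ((\<lambda>\<tau>. f x \<tau>) has_vector_derivative deriv_t T f x t) (at t within {0..<T})"
  unfolding smooth_family_def using C_k_family_SucD(2) by blast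

lemma smooth_family_deriv_x: "smooth_family T f \<Longrightarrow> smooth_family T (deriv_x f)"
  unfolding smooth_family_def using C_k_family_SucD(3) by blast

lemma smooth_family_deriv_t: "smooth_family T f \<Longrightarrow> smooth_family T (deriv_t T f)"
  unfolding smooth_family_def using C_k_family_SucD(4) by blast

lemma smooth_family_continuous:
  "smooth_family T f \<Longrightarrow> continuous_on (UNIV \<times> {0..<T}) (\<lambda>(x, t). f x t)"
  unfolding smooth_family_def using C_k_family_continuous by blast

lemma smooth_family_cong:
  "smooth_family T f \<Longrightarrow> (\<And>x t. t \<in> {0..<T} \<Longrightarrow> g x t = f x t) \<Longrightarrow> smooth_family T g"
  unfolding smooth_family_def using C_k_family_cong by blast

lemma smooth_family_const: "smooth_family T (\<lambda>x t. c)"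
  by (simp add: smooth_family_def C_k_family_const)

lemma smooth_family_add:
  "smooth_family T f \<Longrightarrow> smooth_family T g \<Longrightarrow> smooth_family T (\<lambda>x t. f x t + g x t)"
  by (simp add: smooth_family_def C_k_family_add)

lemma smooth_family_mult:
  fixes f g :: "real \<Rightarrow> real \<Rightarrow> 'a::real_normed_algebra"
  shows "smooth_family T f \<Longrightarrow> smooth_family T g \<Longrightarrow> smooth_family T (\<lambda>x t. f x t * g x t)"
  by (simp add: smooth_family_def C_k_family_bilinear[OF bounded_bilinear_mult])

lemma smooth_family_scaleR:
  "smooth_family T f \<Longrightarrow> smooth_family T g \<Longrightarrow> smooth_family T (\<lambda>x t. f x t *\<^sub>R g x t)"
  by (simp add: smooth_family_def C_k_family_bilinear[OF bounded_bilinear_scaleR])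

lemma smooth_family_inner:
  "smooth_family T f \<Longrightarrow> smooth_family T g \<Longrightarrow> smooth_family T (\<lambda>x t. f x t \<bullet> g x t)"
  by (simp add: smooth_family_def C_k_family_bilinear[OF bounded_bilinear_inner])

lemma smooth_family_linear:
  "bounded_linear h \<Longrightarrow> smooth_family T f \<Longrightarrow> smooth_family T (\<lambda>x t. h (f x t))"
  by (simp add: smooth_family_def C_k_family_linear)

lemma smooth_family_inverse:
  fixes f :: "real \<Rightarrow> real \<Rightarrow> real"
  shows "smooth_family T f \<Longrightarrow> (\<And>x t. t \<in> {0..<T} \<Longrightarrow> f x t \<noteq> 0) \<Longrightarrow>
    smooth_family T (\<lambda>x t. inverse (f x t))"
  unfolding smooth_family_def by (intro allI C_k_family_inverse) auto

lemma smooth_family_norm: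
  fixes f :: "real \<Rightarrow> real \<Rightarrow> 'a::real_inner"
  assumes "smooth_family T f" "\<And>x t. t \<in> {0..<T} \<Longrightarrow> f x t \<noteq> 0"
  shows "smooth_family T (\<lambda>x t. norm (f x t))"
  using smooth_family_inner[OF assms(1) assms(1)] assms(2)
  unfolding smooth_family_def norm_eq_sqrt_inner by (intro allI C_k_family_sqrt) auto

lemma smooth_family_ln:
  fixes f :: "real \<Rightarrow> real \<Rightarrow> real"
  shows "smooth_family T f \<Longrightarrow> (\<And>x t. t \<in> {0..<T} \<Longrightarrow> f x t > 0) \<Longrightarrow>
    smooth_family T (\<lambda>x t. ln (f x t))"
  unfolding smooth_family_def by (intro allI C_k_family_ln) auto

lemma smooth_family_exp:
  fixes f :: "real \<Rightarrow> real \<Rightarrow> real"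
  shows "smooth_family T f \<Longrightarrow> smooth_family T (\<lambda>x t. exp (f x t))"
  by (simp add: smooth_family_def C_k_family_exp)

section \<open>Symmetry of mixed partial derivatives up to the initial time\<close>

lemma mvt_real_within:
  fixes f :: "real \<Rightarrow> real"
  assumes "a < b" "\<And>s. s \<in> {a..b} \<Longrightarrow> (f has_real_derivative f' s) (at s within {a..b})"
  obtains s where "s \<in> {a<..<b}" "f b - f a = f' s * (b - a)"
  using mvt_simple[of a b f "\<lambda>s. (*) (f' s)"] assms that
  by (auto simp: has_field_derivative_def)

text \<open>The second difference of f over a small square is evaluated by the mean value theorem in
  both orders, which gives a value of \<open>fxt\<close> and a value of \<open>ftx\<close> that
  coincide; continuity lets the square shrink to its corner. The square extends only to later times,
  so one-sided time derivatives suffice and t = 0 is included.\<close>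

lemma mixed_partials_eq:
  fixes f fx ft fxt ftx :: "real \<Rightarrow> real \<Rightarrow> real"
  assumes fx: "\<And>x t. t \<in> {0..<T} \<Longrightarrow> ((\<lambda>y. f y t) has_real_derivative fx x t) (at x)"
    and ft: "\<And>x t. t \<in> {0..<T} \<Longrightarrow> (f x has_real_derivative ft x t) (at t within {0..<T})"
    and fxt: "\<And>x t. t \<in> {0..<T} \<Longrightarrow> (fx x has_real_derivative fxt x t) (at t within {0..<T})"
    and ftx: "\<And>x t. t \<in> {0..<T} \<Longrightarrow> ((\<lambda>y. ft y t) has_real_derivative ftx x t) (at x)"
    and cont: "continuous_on (UNIV \<times> {0..<T}) (\<lambda>(x, t). fxt x t)"
      "continuous_on (UNIV \<times> {0..<T}) (\<lambda>(x, t). ftx x t)"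
    and t: "t \<in> {0..<T}"
  shows "fxt x t = ftx x t"
proof -
  have same_value: "\<exists>p q. p \<in> {x<..<x+h} \<times> {t<..<t+h} \<and> q \<in> {x<..<x+h} \<times> {t<..<t+h} \<and>
      fxt (fst p) (snd p) = ftx (fst q) (snd q)" if h: "0 < h" "t + h < T" for h
  proof -
    have sub: "{t..t+h} \<subseteq> {0..<T}" using t h by auto
    have 1: "((\<lambda>y. f y (t+h) - f y t) has_real_derivative fx y (t+h) - fx y t) (at y)" for y
      by (intro DERIV_diff fx) (use t h in auto)
    obtain \<xi> where \<xi>: "\<xi> \<in> {x<..<x+h}"
      "(f (x+h) (t+h) - f (x+h) t) - (f x (t+h) - f x t) = (fx \<xi> (t+h) - fx \<xi> t) * (x + h - x)"
      by (rule mvt_real_within[of x "x+h", OF _ has_field_derivative_at_within[OF 1]]) (use h in auto)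
    obtain \<tau> where \<tau>: "\<tau> \<in> {t<..<t+h}" "fx \<xi> (t+h) - fx \<xi> t = fxt \<xi> \<tau> * (t + h - t)"
      by (rule mvt_real_within[of t "t+h", OF _ has_field_derivative_subset[OF fxt sub]])
        (use h sub in auto)
    have 2: "((\<lambda>s. f (x+h) s - f x s) has_real_derivative ft (x+h) s - ft x s) (at s within {t..t+h})"
      if "s \<in> {t..t+h}" for s
      using that sub by (intro DERIV_diff has_field_derivative_subset[OF ft sub]) auto
    obtain \<tau>' where \<tau>': "\<tau>' \<in> {t<..<t+h}"
      "(f (x+h) (t+h) - f x (t+h)) - (f (x+h) t - f x t) = (ft (x+h) \<tau>' - ft x \<tau>') * (t + h - t)"
      by (rule mvt_real_within[of t "t+h", OF _ 2]) (use h in auto)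
    have \<tau>'_dom: "\<tau>' \<in> {0..<T}" using \<tau>'(1) t h by auto
    obtain \<xi>' where \<xi>': "\<xi>' \<in> {x<..<x+h}"
      "ft (x+h) \<tau>' - ft x \<tau>' = ftx \<xi>' \<tau>' * (x + h - x)"
      by (rule mvt_real_within[of x "x+h", OF _ has_field_derivative_at_within[OF ftx[OF \<tau>'_dom]]])
        (use h in auto)
    have "fxt \<xi> \<tau> * h * h = ftx \<xi>' \<tau>' * h * h"
      using \<xi>(2) \<tau>(2) \<tau>'(2) \<xi>'(2) by (simp add: algebra_simps)
    then have "fxt \<xi> \<tau> = ftx \<xi>' \<tau>'" using h by simp
    then show ?thesis
      using \<xi>(1) \<tau>(1) \<tau>'(1) \<xi>'(1) by (intro exI[of _ "(\<xi>, \<tau>)"] exI[of _ "(\<xi>', \<tau>')"]) auto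
  qed
  have "dist (fxt x t) (ftx x t) \<le> e" if "e > 0" for e
  proof -
    have "(x, t) \<in> UNIV \<times> {0..<T}" using t by simp
    obtain d1 where d1: "d1 > 0" "\<And>p. p \<in> UNIV \<times> {0..<T} \<Longrightarrow> dist p (x, t) < d1 \<Longrightarrow>
        dist (fxt (fst p) (snd p)) (fxt x t) < e / 2"
      using cont(1) t \<open>e > 0\<close> unfolding continuous_on_iff case_prod_unfold
      by (metis \<open>(x, t) \<in> UNIV \<times> {0..<T}\<close> fst_conv half_gt_zero snd_conv)
    obtain d2 where d2: "d2 > 0" "\<And>p. p \<in> UNIV \<times> {0..<T} \<Longrightarrow> dist p (x, t) < d2 \<Longrightarrow>
        dist (ftx (fst p) (snd p)) (ftx x t) < e / 2"
      using cont(2) t \<open>e > 0\<close> unfolding continuous_on_iff case_prod_unfold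
      by (metis \<open>(x, t) \<in> UNIV \<times> {0..<T}\<close> fst_conv half_gt_zero snd_conv)
    \<comment> \<open>The factor 1/2 compensates for bounding the distance in the plane by the sum
      of the two coordinate distances, each less than h; it also keeps t + h below T.\<close>
    define h where "h = min (min d1 d2) (T - t) / 2"
    have h: "h > 0" "t + h < T" "2 * h \<le> d1" "2 * h \<le> d2"
      using d1(1) d2(1) t by (auto simp: h_def min_def field_simps)
    have near: "p \<in> UNIV \<times> {0..<T}" "dist p (x, t) < 2 * h"
      if "p \<in> {x<..<x+h} \<times> {t<..<t+h}" for p
    proof -
      show "p \<in> UNIV \<times> {0..<T}" using that t h by auto
      have "dist p (x, t) \<le> dist (fst p) x + dist (snd p) t"
        unfolding dist_prod_def fst_conv snd_conv by (rule sqrt_sum_squares_le_sum) auto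
      also have "\<dots> < 2 * h" using that by (auto simp: dist_real_def)
      finally show "dist p (x, t) < 2 * h" .
    qed
    obtain p q where p: "p \<in> {x<..<x+h} \<times> {t<..<t+h}" and q: "q \<in> {x<..<x+h} \<times> {t<..<t+h}"
      and eq: "fxt (fst p) (snd p) = ftx (fst q) (snd q)"
      using same_value[OF h(1,2)] by blast
    have "dist (fxt (fst p) (snd p)) (fxt x t) < e / 2"
      by (rule d1(2)) (use near[OF p] h in auto)
    moreover have "dist (fxt (fst p) (snd p)) (ftx x t) < e / 2"
      unfolding eq by (rule d2(2)) (use near[OF q] h in auto)
    ultimately show ?thesis
      using dist_triangle3[of "fxt x t" "ftx x t" "fxt (fst p) (snd p)"] by linarith
  qed
  then have "dist (fxt x t) (ftx x t) \<le> 0" by (rule field_le_epsilon) simp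
  then show ?thesis by simp
qed

text \<open>Testing against an arbitrary fixed vector c reduces the vector-valued case to the scalar
  one.\<close>

lemma deriv_t_deriv_x:
  fixes f :: "real \<Rightarrow> real \<Rightarrow> 'a::real_inner"
  assumes f: "smooth_family T f" and t: "t \<in> {0..<T}"
  shows "deriv_t T (deriv_x f) x t = deriv_x (deriv_t T f) x t"
proof (rule vector_eq_rdot[THEN iffD1, rule_format])
  fix c :: 'a
  note inner = bounded_bilinear.has_vector_derivative[OF bounded_bilinear_inner
      has_vector_derivative_const[of c], simplified]
  note fx = smooth_family_deriv_x[OF f] and ft = smooth_family_deriv_t[OF f]
  have cont: "continuous_on (UNIV \<times> {0..<T}) (\<lambda>(x, t). c \<bullet> g x t)" if "smooth_family T g" for g
    using smooth_family_continuous[OF smooth_family_inner[OF smooth_family_const that]] .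
  have "c \<bullet> deriv_t T (deriv_x f) x t = c \<bullet> deriv_x (deriv_t T f) x t"
    by (rule mixed_partials_eq[where f = "\<lambda>x t. c \<bullet> f x t" and fx = "\<lambda>x t. c \<bullet> deriv_x f x t"
          and ft = "\<lambda>x t. c \<bullet> deriv_t T f x t" and fxt = "\<lambda>x t. c \<bullet> deriv_t T (deriv_x f) x t"
          and ftx = "\<lambda>x t. c \<bullet> deriv_x (deriv_t T f) x t" and T = T])
      (intro inner[folded has_real_derivative_iff_has_vector_derivative]
        smooth_family_has_deriv_x[where T = T] smooth_family_has_deriv_t cont smooth_family_deriv_x smooth_family_deriv_t f t; assumption)+
  then show "deriv_t T (deriv_x f) x t \<bullet> c = deriv_x (deriv_t T f) x t \<bullet> c"
    by (simp add: inner_commute)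
qed

section \<open>Maximum principle\<close>

text \<open>Subtracting floor(x / P) periods moves x into \<open>{0..P}\<close>. This supplies the
  compactness that the maximum principle needs on the noncompact parameter line.\<close>

lemma periodic_reduce:
  fixes g :: "real \<Rightarrow> 'a"
  assumes P: "P > 0" and per: "\<And>x. g (x + P) = g x"
  shows "\<exists>y\<in>{0..P}. g y = g x"
proof
  have "g (x + of_int n * P) = g x" for n
  proof (induction n rule: int_induct[where k = 0])
    case (step1 i)
    then show ?case using per[of "x + of_int i * P"] by (simp add: algebra_simps)
  next
    case (step2 i)
    then show ?case using per[of "x + of_int (i - 1) * P"] by (simp add: algebra_simps)
  qed simp
  then show "g (x + of_int (- \<lfloor>x / P\<rfloor>) * P) = g x" .
  have "of_int \<lfloor>x / P\<rfloor> \<le> x / P" "x / P \<le> of_int \<lfloor>x / P\<rfloor> + 1" by linarith+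
  then have "of_int \<lfloor>x / P\<rfloor> * P \<le> x" "x \<le> (of_int \<lfloor>x / P\<rfloor> + 1) * P"
    using P by (simp_all only: pos_le_divide_eq pos_divide_le_eq)
  then show "x + of_int (- \<lfloor>x / P\<rfloor>) * P \<in> {0..P}"
    by (simp add: algebra_simps)
qed

text \<open>At the first time \<open>f\<close> vanishes somewhere, \<open>f\<close> has a spatial minimum there and has
  decreased to it.\<close>

lemma first_zero_max_principle:
  fixes f :: "real \<Rightarrow> real \<Rightarrow> real"
  assumes cont: "continuous_on (UNIV \<times> {a..b}) (\<lambda>(x, t). f x t)"
    and P: "P > 0" and per: "\<And>x t. t \<in> {a..b} \<Longrightarrow> f (x + P) t = f x t"
    and init: "\<And>x. f x a > 0"
    and touch: "\<And>x t. t \<in> {a<..b} \<Longrightarrow> f x t = 0 \<Longrightarrow> (\<And>y. f y t \<ge> 0) \<Longrightarrow>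
      \<exists>d>0. (f x has_real_derivative d) (at t within {a..t})"
    and t: "t \<in> {a..b}"
  shows "f x t > 0"
proof (rule ccontr)
  assume "\<not> f x t > 0"
  have reduce: "\<exists>y'\<in>{0..P}. \<forall>s\<in>{a..b}. f y' s = f y s" for y
  proof -
    \<comment> \<open>Periodicity is known only for times in \<open>{a..b}\<close>. Applying
      \<open>periodic_reduce\<close> to whole time profiles, truncated to 0 elsewhere, yields one
      representative that works for all these times simultaneously.\<close>
    have "(\<lambda>s. if s \<in> {a..b} then f (x + P) s else 0) = (\<lambda>s. if s \<in> {a..b} then f x s else 0)" for x
      using per by auto
    from periodic_reduce[OF P, of "\<lambda>y s. if s \<in> {a..b} then f y s else 0", OF this, of y]
    show ?thesis by (metis (no_types, lifting))
  qed
  \<comment> \<open>K collects the nonpositive points within one period. It is compact, so it has a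
    point of least time; the initial condition puts that time strictly after a.\<close>
  define K where "K = ({0..P} \<times> {a..b}) \<inter> (\<lambda>(x, t). f x t) -` {..0}"
  have "closed K"
    unfolding K_def
    by (intro continuous_closed_preimage continuous_on_subset[OF cont] closed_Times) auto
  then have "compact ({0..P} \<times> {a..b} \<inter> K)"
    using compact_Int_closed[OF compact_Times[OF compact_Icc[of 0 P] compact_Icc[of a b]]]
    by blast
  then have "compact K" by (simp add: K_def)
  obtain x' where "x' \<in> {0..P}" "\<forall>s\<in>{a..b}. f x' s = f x s" using reduce by blast
  then have "(x', t) \<in> K" using t \<open>\<not> f x t > 0\<close> by (simp add: K_def not_less)
  then have "K \<noteq> {}" by auto
  obtain p where p: "p \<in> K" "\<And>q. q \<in> K \<Longrightarrow> snd p \<le> snd q"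
    using continuous_attains_inf[OF \<open>compact K\<close> \<open>K \<noteq> {}\<close> continuous_on_snd[OF continuous_on_id]]
    by blast
  define x0 t0 where "x0 = fst p" and "t0 = snd p"
  have t0: "t0 \<in> {a<..b}" "f x0 t0 \<le> 0"
    using p(1) init[of x0] unfolding K_def x0_def t0_def
    by (auto simp: case_prod_unfold not_le less_le)
  have pos: "f y s > 0" if "s \<in> {a..<t0}" for y s
  proof (rule ccontr)
    obtain y' where "y' \<in> {0..P}" "\<forall>s\<in>{a..b}. f y' s = f y s" using reduce by blast
    moreover assume "\<not> f y s > 0"
    ultimately have "(y', s) \<in> K" using that t0 by (auto simp: K_def)
    from p(2)[OF this] show False using that by (simp add: t0_def)
  qed
  have nonneg: "f y t0 \<ge> 0" for y
  proof (rule tendsto_lowerbound)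
    have "continuous_on {a..b} (\<lambda>s. (case (y, s) of (x, t) \<Rightarrow> f x t))"
      by (rule continuous_on_compose2[OF cont]) (auto intro: continuous_on_Pair)
    then have "continuous_on {a..b} (f y)" by simp
    then have "(f y \<longlongrightarrow> f y t0) (at t0 within {a..b})"
      using t0 by (auto simp: continuous_on)
    then have "(f y \<longlongrightarrow> f y t0) (at t0 within {a..t0})"
      by (rule tendsto_within_subset) (use t0 in auto)
    then show "(f y \<longlongrightarrow> f y t0) (at_left t0)"
      using at_within_Icc_at_left[of a t0] t0(1) by simp
    show "\<forall>\<^sub>F s in at_left t0. 0 \<le> f y s"
      using t0 pos by (auto simp: eventually_at_left intro!: exI[of _ a] less_imp_le)
  qed simp
  have zero: "f x0 t0 = 0" using t0(2) nonneg[of x0] by simp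
  obtain d where d: "d > 0" "(f x0 has_real_derivative d) (at t0 within {a..t0})"
    using touch[OF t0(1) zero nonneg] by blast
  \<comment> \<open>A positive left derivative at a zero forces negative values just before
    \<open>t0\<close>, against the positivity at all earlier times.\<close>
  from has_real_derivative_pos_inc_left[OF d(2,1)] obtain e where "e > 0"
    and e: "\<And>h. h > 0 \<Longrightarrow> t0 - h \<in> {a..t0} \<Longrightarrow> h < e \<Longrightarrow> f x0 (t0 - h) < f x0 t0" by blast
  define h where "h = min (e / 2) (t0 - a)"
  have "h > 0" "h < e" "t0 - h \<in> {a..<t0}" using \<open>e > 0\<close> t0 by (auto simp: h_def min_def)
  then show False using e[of h] pos[of "t0 - h" x0] zero by auto
qed

text \<open>If f'' were negative, f' would be negative immediately to the right of x, since it
  vanishes at x; the mean value theorem would then produce a value of f below the minimum.\<close>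

lemma spatial_min_deriv:
  fixes f :: "real \<Rightarrow> real"
  assumes f': "\<And>y. (f has_real_derivative f' y) (at y)"
    and f'': "(f' has_real_derivative f'') (at x)"
    and min: "\<And>y. f x \<le> f y"
  shows "f' x = 0" "f'' \<ge> 0"
proof -
  show 0: "f' x = 0"
    by (rule DERIV_local_min[OF f', of 1]) (use min in auto)
  show "f'' \<ge> 0"
  proof (rule ccontr)
    assume "\<not> f'' \<ge> 0"
    then have "f'' < 0" by simp
    from DERIV_neg_dec_right[OF f'' this] obtain e where "e > 0"
      and e: "\<And>h. h > 0 \<Longrightarrow> h < e \<Longrightarrow> f' (x + h) < f' x" by blast
    obtain z where "z > x" "z < x + e / 2" "f (x + e / 2) - f x = (x + e / 2 - x) * f' z"
      using MVT2[of x "x + e / 2" f f'] f' \<open>e > 0\<close> by auto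
    moreover have "f' z < 0" using e[of "z - x"] 0 \<open>z > x\<close> \<open>z < x + e / 2\<close> by simp
    ultimately have "f (x + e / 2) - f x = e / 2 * f' z" "e / 2 * f' z < 0"
      using \<open>e > 0\<close> by (simp_all add: mult_less_0_iff)
    then have "f (x + e / 2) < f x" by linarith
    with min[of "x + e / 2"] show False by simp
  qed
qed

section \<open>Differentiation rules in time\<close>

lemma deriv_t_cong:
  assumes "t \<in> {0..<T}" "\<And>s. s \<in> {0..<T} \<Longrightarrow> f x s = g x s" "smooth_family T g"
  shows "deriv_t T f x t = deriv_t T g x t"
proof (rule deriv_t_eq[OF assms(1)])
  show "((\<lambda>\<tau>. f x \<tau>) has_vector_derivative deriv_t T g x t) (at t within {0..<T})"
    by (rule has_vector_derivative_transform[OF assms(1) assms(2) smooth_family_has_deriv_t[OF assms(3,1)]])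
qed

lemma deriv_t_const: "t \<in> {0..<T} \<Longrightarrow> deriv_t T (\<lambda>x t. c) x t = 0"
  by (rule deriv_t_eq) auto

lemma deriv_t_add:
  assumes "smooth_family T f" "smooth_family T g" "t \<in> {0..<T}"
  shows "deriv_t T (\<lambda>x t. f x t + g x t) x t = deriv_t T f x t + deriv_t T g x t"
  by (intro deriv_t_eq has_vector_derivative_add smooth_family_has_deriv_t assms)

lemma deriv_t_bilinear:
  assumes "bounded_bilinear h" "smooth_family T f" "smooth_family T g" "t \<in> {0..<T}"
  shows "deriv_t T (\<lambda>x t. h (f x t) (g x t)) x t =
    h (f x t) (deriv_t T g x t) + h (deriv_t T f x t) (g x t)"
  by (intro deriv_t_eq bounded_bilinear.has_vector_derivative smooth_family_has_deriv_t assms)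

lemma deriv_t_exp:
  fixes f :: "real \<Rightarrow> real \<Rightarrow> real"
  assumes "smooth_family T f" "t \<in> {0..<T}"
  shows "deriv_t T (\<lambda>x t. exp (f x t)) x t = exp (f x t) * deriv_t T f x t"
  using DERIV_chain2[OF DERIV_exp, of "f x"] smooth_family_has_deriv_t[OF assms, of x]
  unfolding has_real_derivative_iff_has_vector_derivative[symmetric]
  by (intro deriv_t_eq assms) (simp add: has_real_derivative_iff_has_vector_derivative[symmetric])

section \<open>Arc-length derivative and evolution equations\<close>

locale immersed_family =
  fixes T :: real and \<gamma> :: "real \<Rightarrow> real \<Rightarrow> real^2"
  assumes smooth: "smooth_family T \<gamma>"
    and immersed: "\<And>x t. t \<in> {0..<T} \<Longrightarrow> deriv_x \<gamma> x t \<noteq> 0"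
begin

abbreviation speed :: "real \<Rightarrow> real \<Rightarrow> real" where
  "speed x t \<equiv> norm (deriv_x \<gamma> x t)"

abbreviation D :: "(real \<Rightarrow> real \<Rightarrow> 'a::real_normed_vector) \<Rightarrow> real \<Rightarrow> real \<Rightarrow> 'a" where
  "D \<equiv> deriv_s \<gamma>"

lemma smooth_speed: "smooth_family T speed"
  by (intro smooth_family_norm smooth_family_deriv_x smooth immersed)

lemma smooth_D: "smooth_family T f \<Longrightarrow> smooth_family T (D f)"
  unfolding deriv_s_def inverse_eq_divide[symmetric]
  by (intro smooth_family_scaleR smooth_family_inverse smooth_speed smooth_family_deriv_x)
    (use immersed in auto)

lemma deriv_x_D: "t \<in> {0..<T} \<Longrightarrow> deriv_x f x t = speed x t *\<^sub>R D f x t"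
  using immersed[of t x] by (simp add: deriv_s_def)

lemma has_D:
  "smooth_family T f \<Longrightarrow> t \<in> {0..<T} \<Longrightarrow>
    ((\<lambda>y. f y t) has_vector_derivative speed x t *\<^sub>R D f x t) (at x)"
  by (simp only: deriv_x_D[symmetric] smooth_family_has_deriv_x)

text \<open>Cancelling the nonzero speed reduces rules for \<open>D\<close> to the corresponding
  rules for the parameter derivative.\<close>

lemma D_eqI:
  assumes "((\<lambda>y. f y t) has_vector_derivative speed x t *\<^sub>R d) (at x)" "t \<in> {0..<T}"
  shows "D f x t = d"
  using deriv_x_eq[of f t, OF assms(1)] immersed[OF assms(2), of x] by (simp add: deriv_s_def)

lemma D_cong: "(\<And>y. f y t = g y t) \<Longrightarrow> D f x t = D g x t"
  by (simp add: deriv_s_def deriv_x_def)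

lemma D_const: "D (\<lambda>x t. c) x t = 0"
  by (simp add: deriv_s_def deriv_x_def)

lemma D_add:
  assumes "smooth_family T f" "smooth_family T g" "t \<in> {0..<T}"
  shows "D (\<lambda>x t. f x t + g x t) x t = D f x t + D g x t"
  by (rule D_eqI) (simp_all add: scaleR_add_right has_vector_derivative_add has_D assms del: atLeastLessThan_iff)

lemma D_bilinear:
  assumes h: "bounded_bilinear h" and "smooth_family T f" "smooth_family T g" "t \<in> {0..<T}"
  shows "D (\<lambda>x t. h (f x t) (g x t)) x t = h (f x t) (D g x t) + h (D f x t) (g x t)"
proof (rule D_eqI[OF _ assms(4)])
  from bounded_bilinear.has_vector_derivative[OF h has_D[OF assms(2,4)] has_D[OF assms(3,4)], of x]
  show "((\<lambda>y. h (f y t) (g y t)) has_vector_derivative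
      speed x t *\<^sub>R (h (f x t) (D g x t) + h (D f x t) (g x t))) (at x)"
    by (simp add: bounded_bilinear.scaleR_left[OF h] bounded_bilinear.scaleR_right[OF h] scaleR_add_right)
qed

lemma D_exp:
  fixes f :: "real \<Rightarrow> real \<Rightarrow> real"
  assumes "smooth_family T f" "t \<in> {0..<T}"
  shows "D (\<lambda>x t. exp (f x t)) x t = exp (f x t) * D f x t"
proof (rule D_eqI[OF _ assms(2)])
  from has_D[OF assms, of x]
  have "((\<lambda>y. f y t) has_real_derivative speed x t * D f x t) (at x)"
    by (simp add: has_real_derivative_iff_has_vector_derivative)
  from DERIV_fun_exp[OF this]
  show "((\<lambda>y. exp (f y t)) has_vector_derivative speed x t *\<^sub>R (exp (f x t) * D f x t)) (at x)"
    by (simp add: has_real_derivative_iff_has_vector_derivative mult_ac)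
qed

lemma D_periodic:
  assumes \<gamma>: "\<And>x t. t \<in> {0..<T} \<Longrightarrow> \<gamma> (x + P) t = \<gamma> x t"
    and f: "smooth_family T f" "\<And>x t. t \<in> {0..<T} \<Longrightarrow> f (x + P) t = f x t"
    and t: "t \<in> {0..<T}"
  shows "D f (x + P) t = D f x t"
proof -
  \<comment> \<open>Stated for a general g because it is needed twice: for \<gamma>, to make the
    speed periodic, and for f.\<close>
  have "deriv_x g (x + P) t = deriv_x g x t"
    if g: "smooth_family T g" "\<And>x. g (x + P) t = g x t" for g :: "real \<Rightarrow> real \<Rightarrow> 'b::real_normed_vector"
  proof -
    have "((\<lambda>y. y + P) has_vector_derivative 1) (at x)"
      using has_vector_derivative_add_const[of "\<lambda>y. y" P 1] by simp
    from vector_diff_chain_at[OF this smooth_family_has_deriv_x[OF g(1) t]]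
    have "((\<lambda>y. g y t) has_vector_derivative deriv_x g (x + P) t) (at x)"
      by (simp add: o_def g(2))
    then show ?thesis by (rule deriv_x_eq[symmetric])
  qed
  from this[of \<gamma>, OF smooth \<gamma>[OF t]] this[of f, OF f(1) f(2)[OF t]]
  show ?thesis by (simp add: deriv_s_def)
qed

text \<open>With v the speed, f_x = v f_s and f_xx = v^2 f_ss + v_x f_s. At a minimum f_s = 0
  removes the reparametrisation term, so f_ss inherits the sign of f_xx.\<close>

lemma D_at_spatial_min:
  fixes f :: "real \<Rightarrow> real \<Rightarrow> real"
  assumes f: "smooth_family T f" and t: "t \<in> {0..<T}" and min: "\<And>y. f x t \<le> f y t"
  shows "D f x t = 0" "D (D f) x t \<ge> 0"
proof -
  have f': "((\<lambda>y. f y t) has_real_derivative speed y t * D f y t) (at y)" for y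
    using has_D[OF f t] by (simp add: has_real_derivative_iff_has_vector_derivative)
  have f'': "((\<lambda>y. speed y t * D f y t) has_real_derivative
      speed x t * (speed x t * D (D f) x t) + deriv_x speed x t * D f x t) (at x)"
    using bounded_bilinear.has_vector_derivative[OF bounded_bilinear_mult
        smooth_family_has_deriv_x[OF smooth_speed t] has_D[OF smooth_D[OF f] t]]
    by (simp add: has_real_derivative_iff_has_vector_derivative)
  note sp = spatial_min_deriv[OF f' f'' min]
  have pos: "speed x t > 0" using immersed[OF t] by simp
  then show 0: "D f x t = 0" using sp(1) immersed[OF t, of x] by simp
  show "D (D f) x t \<ge> 0" using sp(2) pos unfolding 0 by (simp add: zero_le_mult_iff)
qed

lemma norm_unit_tangent: "t \<in> {0..<T} \<Longrightarrow> norm (unit_tangent \<gamma> x t) = 1"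
  using immersed[of t x] by (simp add: unit_tangent_def deriv_s_def)

lemma smooth_unit_tangent: "smooth_family T (unit_tangent \<gamma>)"
  unfolding unit_tangent_def by (rule smooth_D[OF smooth])

end

section \<open>The unit normal as a rotated tangent, and regularity of the curvature\<close>

definition rot90 :: "real^2 \<Rightarrow> real^2" where
  "rot90 v = vector [- v $ 2, v $ 1]"

lemma bounded_linear_rot90: "bounded_linear rot90"
  unfolding linear_conv_bounded_linear[symmetric]
  by (rule linearI) (auto simp: rot90_def vec_eq_iff forall_2)

lemma orthogonal_unit_eq_rot90:
  assumes "norm \<tau> = 1" "\<nu> \<bullet> \<tau> = 0"
  shows "\<nu> = (\<nu> \<bullet> rot90 \<tau>) *\<^sub>R rot90 \<tau>"
proof -
  have 1: "\<tau> $ 1 * \<tau> $ 1 + \<tau> $ 2 * \<tau> $ 2 = 1"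
    using assms(1) by (simp add: norm_eq_1 inner_vec_def sum_2)
  have 2: "\<nu> $ 1 * \<tau> $ 1 + \<nu> $ 2 * \<tau> $ 2 = 0"
    using assms(2) by (simp add: inner_vec_def sum_2)
  have "\<nu> $ 1 = (\<nu> $ 2 * \<tau> $ 1 - \<nu> $ 1 * \<tau> $ 2) * (- \<tau> $ 2)"
    "\<nu> $ 2 = (\<nu> $ 2 * \<tau> $ 1 - \<nu> $ 1 * \<tau> $ 2) * \<tau> $ 1"
    using 1 2 by algebra+
  then show ?thesis
    by (simp add: vec_eq_iff forall_2 rot90_def inner_vec_def sum_2)
qed

locale curve_flow = immersed_family +
  fixes N :: "real \<Rightarrow> real \<Rightarrow> real^2" and \<kappa> :: "real \<Rightarrow> real \<Rightarrow> real"
  assumes normal: "unit_normal_field T \<gamma> N"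
    and curvature: "is_curvature T \<gamma> N \<kappa>"
    and flow: "curve_shortening_flow T \<gamma> N \<kappa>"
begin

lemma N_unit: "t \<in> {0..<T} \<Longrightarrow> N x t \<bullet> N x t = 1"
  and N_orthogonal: "t \<in> {0..<T} \<Longrightarrow> N x t \<bullet> unit_tangent \<gamma> x t = 0"
  using normal unfolding unit_normal_field_def by (auto simp: norm_eq_1)

text \<open>The normal is given only as a continuous field. Its coefficient against the rotated
  tangent is continuous with values in {1, -1} on the connected strip of parameters and times, hence
  constant. Smoothness and periodicity of N are then inherited from the tangent.\<close>

lemma N_eq_rot90: "\<exists>\<sigma>. \<forall>x. \<forall>t\<in>{0..<T}. N x t = \<sigma> *\<^sub>R rot90 (unit_tangent \<gamma> x t)"
proof -
  define \<sigma> where "\<sigma> = (\<lambda>(x, t). N x t \<bullet> rot90 (unit_tangent \<gamma> x t))"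
  have N: "N x t = \<sigma> (x, t) *\<^sub>R rot90 (unit_tangent \<gamma> x t)" if "t \<in> {0..<T}" for x t
    using orthogonal_unit_eq_rot90[OF norm_unit_tangent N_orthogonal, OF that that, of x]
    by (simp add: \<sigma>_def)
  have "\<sigma> p \<in> {1, -1}" if p: "p \<in> UNIV \<times> {0..<T}" for p
  proof -
    obtain x t where p': "p = (x, t)" "t \<in> {0..<T}" using p by auto
    have "N x t \<bullet> N x t = \<sigma> p * (N x t \<bullet> rot90 (unit_tangent \<gamma> x t))"
      using N[OF p'(2), of x] unfolding p'(1) by (metis inner_scaleR_right)
    then have "\<sigma> p * \<sigma> p = 1" using N_unit[OF p'(2), of x] by (simp add: \<sigma>_def p'(1))
    then show ?thesis using square_eq_1_iff by blast
  qed
  then have "\<sigma> ` (UNIV \<times> {0..<T}) \<subseteq> {1, -1}" by blast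
  then have "finite (\<sigma> ` (UNIV \<times> {0..<T}))" by (rule finite_subset) simp
  moreover have "continuous_on (UNIV \<times> {0..<T}) \<sigma>"
    using smooth_family_continuous[OF smooth_family_linear[OF bounded_linear_rot90 smooth_unit_tangent]]
      normal unfolding unit_normal_field_def \<sigma>_def case_prod_unfold
    by (intro continuous_on_inner) auto
  moreover have "connected ((UNIV :: real set) \<times> {0..<T})"
    by (intro convex_connected convex_Times) auto
  ultimately have "\<sigma> constant_on UNIV \<times> {0..<T}"
    by (intro continuous_finite_range_constant)
  then obtain c where "\<And>p. p \<in> UNIV \<times> {0..<T} \<Longrightarrow> \<sigma> p = c"
    unfolding constant_on_def by blast
  then show ?thesis using N by (intro exI[of _ c]) auto
qed

lemma smooth_N: "smooth_family T N"
proof -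
  obtain \<sigma> where "\<forall>x. \<forall>t\<in>{0..<T}. N x t = \<sigma> *\<^sub>R rot90 (unit_tangent \<gamma> x t)"
    using N_eq_rot90 by blast
  then show ?thesis
    by (intro smooth_family_cong[OF smooth_family_scaleR[OF smooth_family_const[of T \<sigma>]
            smooth_family_linear[OF bounded_linear_rot90 smooth_unit_tangent]]]) simp
qed

lemma D_unit_tangent: "t \<in> {0..<T} \<Longrightarrow> D (unit_tangent \<gamma>) x t = \<kappa> x t *\<^sub>R N x t"
  and D_N: "t \<in> {0..<T} \<Longrightarrow> D N x t = - (\<kappa> x t *\<^sub>R unit_tangent \<gamma> x t)"
  using curvature unfolding is_curvature_def by blast+

text \<open>Expresses \<kappa> through the tangent and the normal, whose smoothness and periodicity
  it thereby acquires.\<close>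

lemma \<kappa>_eq_inner: "t \<in> {0..<T} \<Longrightarrow> \<kappa> x t = D (unit_tangent \<gamma>) x t \<bullet> N x t"
  by (simp add: D_unit_tangent N_unit del: atLeastLessThan_iff)

lemma smooth_\<kappa>: "smooth_family T \<kappa>"
  by (rule smooth_family_cong[OF smooth_family_inner[OF smooth_D[OF smooth_unit_tangent] smooth_N]
        \<kappa>_eq_inner])

lemma \<kappa>_periodic:
  assumes \<gamma>: "\<And>x t. t \<in> {0..<T} \<Longrightarrow> \<gamma> (x + P) t = \<gamma> x t" and t: "t \<in> {0..<T}"
  shows "\<kappa> (x + P) t = \<kappa> x t"
proof -
  obtain \<sigma> where \<sigma>: "\<forall>x. \<forall>t\<in>{0..<T}. N x t = \<sigma> *\<^sub>R rot90 (unit_tangent \<gamma> x t)"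
    using N_eq_rot90 by blast
  have T: "unit_tangent \<gamma> (x + P) t = unit_tangent \<gamma> x t" if "t \<in> {0..<T}" for x t
    unfolding unit_tangent_def by (rule D_periodic[where P = P and f = \<gamma>, OF \<gamma> smooth \<gamma> that])
  have "N (x + P) t = N x t" using \<sigma> t T[OF t, of x] by metis
  then show ?thesis
    by (simp only: \<kappa>_eq_inner[OF t]
        D_periodic[where P = P and f = "unit_tangent \<gamma>", OF \<gamma> smooth_unit_tangent T t])
qed

section \<open>Evolution of the length element, the tangent and the curvature\<close>

lemma deriv_t_\<gamma>: "t \<in> {0..<T} \<Longrightarrow> deriv_t T \<gamma> x t = \<kappa> x t *\<^sub>R N x t"
  by (rule deriv_t_eq) (use flow in \<open>auto simp: curve_shortening_flow_def\<close>)

lemma D_deriv_t_\<gamma>: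
  assumes t: "t \<in> {0..<T}"
  shows "D (deriv_t T \<gamma>) x t = D \<kappa> x t *\<^sub>R N x t - (\<kappa> x t)\<^sup>2 *\<^sub>R unit_tangent \<gamma> x t"
proof -
  have "D (deriv_t T \<gamma>) x t = D (\<lambda>x t. \<kappa> x t *\<^sub>R N x t) x t"
    by (rule D_cong) (rule deriv_t_\<gamma>[OF t])
  also have "\<dots> = \<kappa> x t *\<^sub>R D N x t + D \<kappa> x t *\<^sub>R N x t"
    by (rule D_bilinear[OF bounded_bilinear_scaleR smooth_\<kappa> smooth_N t])
  finally show ?thesis by (simp add: D_N[OF t] power2_eq_square)
qed

text \<open>Differentiate the squared speed in time and exchange the x- and t-derivatives of
  \<gamma>. Only the tangential part of the s-derivative of the velocity \<kappa>N survives the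
  inner product with \<gamma>_x.\<close>

lemma deriv_t_speed:
  assumes t: "t \<in> {0..<T}"
  shows "deriv_t T speed x t = - ((\<kappa> x t)\<^sup>2 * speed x t)"
proof -
  note gx = smooth_family_deriv_x[OF smooth]
  have "deriv_t T (deriv_x \<gamma>) x t = speed x t *\<^sub>R D (deriv_t T \<gamma>) x t"
    by (simp only: deriv_t_deriv_x[OF smooth t] deriv_x_D[OF t, of "deriv_t T \<gamma>"])
  moreover have "deriv_x \<gamma> x t = speed x t *\<^sub>R unit_tangent \<gamma> x t"
    unfolding unit_tangent_def by (rule deriv_x_D[OF t])
  ultimately have "deriv_x \<gamma> x t \<bullet> deriv_t T (deriv_x \<gamma>) x t =
      (speed x t *\<^sub>R unit_tangent \<gamma> x t) \<bullet> (speed x t *\<^sub>R D (deriv_t T \<gamma>) x t)"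
    by (rule arg_cong2[where f = inner, rotated])
  also have "\<dots> = - ((\<kappa> x t)\<^sup>2 * speed x t * speed x t)"
    using norm_unit_tangent[OF t, of x] N_orthogonal[OF t, of x]
    by (simp add: D_deriv_t_\<gamma>[OF t] inner_diff_right norm_eq_1 inner_commute)
  finally have inner: "deriv_x \<gamma> x t \<bullet> deriv_t T (deriv_x \<gamma>) x t =
    - ((\<kappa> x t)\<^sup>2 * speed x t * speed x t)" .
  have "2 * speed x t * deriv_t T speed x t = deriv_t T (\<lambda>x t. speed x t * speed x t) x t"
    using deriv_t_bilinear[OF bounded_bilinear_mult smooth_speed smooth_speed t, of x] by simp
  also have "\<dots> = deriv_t T (\<lambda>x t. deriv_x \<gamma> x t \<bullet> deriv_x \<gamma> x t) x t"
    by (simp add: power2_eq_square[symmetric] power2_norm_eq_inner)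
  also have "\<dots> = 2 * (deriv_x \<gamma> x t \<bullet> deriv_t T (deriv_x \<gamma>) x t)"
    using deriv_t_bilinear[OF bounded_bilinear_inner gx gx t, of x] by (simp add: inner_commute)
  finally have "speed x t * deriv_t T speed x t = speed x t * - ((\<kappa> x t)\<^sup>2 * speed x t)"
    unfolding inner by simp
  then show ?thesis using immersed[OF t, of x] by (simp only: mult_cancel_left) simp
qed

text \<open>The parameter and time derivatives commute, so the whole commutator comes from
  differentiating the speed v in f_x = v f_s, with v_t = -\<kappa>^2 v.\<close>

lemma deriv_t_D:
  fixes f :: "real \<Rightarrow> real \<Rightarrow> 'a::real_inner"
  assumes f: "smooth_family T f" and t: "t \<in> {0..<T}"
  shows "deriv_t T (D f) x t = D (deriv_t T f) x t + (\<kappa> x t)\<^sup>2 *\<^sub>R D f x t"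
proof -
  have "speed x t *\<^sub>R D (deriv_t T f) x t = deriv_t T (deriv_x f) x t"
    by (simp only: deriv_t_deriv_x[OF f t] deriv_x_D[OF t, of "deriv_t T f"])
  also have "\<dots> = deriv_t T (\<lambda>x t. speed x t *\<^sub>R D f x t) x t"
    by (intro deriv_t_cong t deriv_x_D smooth_family_scaleR smooth_speed smooth_D f)
  also have "\<dots> = speed x t *\<^sub>R deriv_t T (D f) x t + deriv_t T speed x t *\<^sub>R D f x t"
    by (rule deriv_t_bilinear[OF bounded_bilinear_scaleR smooth_speed smooth_D[OF f] t])
  finally have "speed x t *\<^sub>R deriv_t T (D f) x t =
      speed x t *\<^sub>R (D (deriv_t T f) x t + (\<kappa> x t)\<^sup>2 *\<^sub>R D f x t)"
    by (simp add: deriv_t_speed[OF t] scaleR_add_right mult.commute)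
  then show ?thesis using immersed[OF t, of x] by simp
qed

text \<open>The Frenet equation for the derivative of the tangent is differentiated in time, once as
  the product \<kappa>N and once through the commutator; the normal components are compared.\<close>

lemma deriv_t_\<kappa>:
  assumes t: "t \<in> {0..<T}"
  shows "deriv_t T \<kappa> x t = D (D \<kappa>) x t + (\<kappa> x t) ^ 3"
proof -
  \<comment> \<open>The tangential term -\<kappa>^2 of the differentiated velocity cancels the
    commutator term.\<close>
  have tangent: "deriv_t T (unit_tangent \<gamma>) x t = D \<kappa> x t *\<^sub>R N x t" if "t \<in> {0..<T}" for x t
    using deriv_t_D[OF smooth that, of x]
    by (simp add: D_deriv_t_\<gamma>[OF that] unit_tangent_def)
  have "\<kappa> x t *\<^sub>R deriv_t T N x t + deriv_t T \<kappa> x t *\<^sub>R N x t = deriv_t T (\<lambda>x t. \<kappa> x t *\<^sub>R N x t) x t"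
    by (rule deriv_t_bilinear[OF bounded_bilinear_scaleR smooth_\<kappa> smooth_N t, symmetric])
  also have "\<dots> = deriv_t T (D (unit_tangent \<gamma>)) x t"
    by (rule deriv_t_cong[OF t D_unit_tangent[symmetric] smooth_D[OF smooth_unit_tangent]])
  also have "\<dots> = D (deriv_t T (unit_tangent \<gamma>)) x t + (\<kappa> x t)\<^sup>2 *\<^sub>R (\<kappa> x t *\<^sub>R N x t)"
    by (simp add: deriv_t_D[OF smooth_unit_tangent t] D_unit_tangent[OF t])
  also have "D (deriv_t T (unit_tangent \<gamma>)) x t = D (\<lambda>x t. D \<kappa> x t *\<^sub>R N x t) x t"
    by (rule D_cong) (rule tangent[OF t])
  also have "\<dots> = D \<kappa> x t *\<^sub>R D N x t + D (D \<kappa>) x t *\<^sub>R N x t"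
    by (rule D_bilinear[OF bounded_bilinear_scaleR smooth_D[OF smooth_\<kappa>] smooth_N t])
  finally have eq: "\<kappa> x t *\<^sub>R deriv_t T N x t + deriv_t T \<kappa> x t *\<^sub>R N x t =
      D \<kappa> x t *\<^sub>R D N x t + D (D \<kappa>) x t *\<^sub>R N x t + (\<kappa> x t)\<^sup>2 *\<^sub>R (\<kappa> x t *\<^sub>R N x t)" .
  have "deriv_t T (\<lambda>x t. N x t \<bullet> N x t) x t = 0"
    using deriv_t_cong[OF t, of "\<lambda>x t. N x t \<bullet> N x t" x "\<lambda>x t. 1"] N_unit
    by (simp add: smooth_family_const deriv_t_const[OF t] del: atLeastLessThan_iff)
  then have NN: "N x t \<bullet> deriv_t T N x t = 0"
    using deriv_t_bilinear[OF bounded_bilinear_inner smooth_N smooth_N t, of x]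
    by (simp add: inner_commute)
  \<comment> \<open>Pairing with N removes both the time derivative of N, orthogonal to N because N
    has unit length, and the s-derivative of N, which is tangential.\<close>
  from arg_cong[OF eq, of "\<lambda>w. N x t \<bullet> w"] show ?thesis
    by (simp add: inner_add_right inner_diff_right NN N_unit[OF t] D_N[OF t] N_orthogonal[OF t]
        power2_eq_square power3_eq_cube)
qed

lemma \<kappa>_pos:
  assumes P: "P > 0" and \<gamma>: "\<And>x t. t \<in> {0..<T} \<Longrightarrow> \<gamma> (x + P) t = \<gamma> x t"
    and init: "\<And>x. \<kappa> x 0 > 0" and t: "t \<in> {0..<T}"
  shows "\<kappa> x t > 0"
proof -
  have T: "0 \<in> {0..<T}" using t by auto
  have "continuous_on {0..P} (\<lambda>x. \<kappa> x 0)"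
    by (intro continuous_at_imp_continuous_on ballI has_vector_derivative_continuous[OF has_D[OF smooth_\<kappa> T]])
  then obtain x0 where x0: "\<And>x. x \<in> {0..P} \<Longrightarrow> \<kappa> x0 0 \<le> \<kappa> x 0"
    using continuous_attains_inf[of "{0..P}" "\<lambda>x. \<kappa> x 0"] P by force
  \<comment> \<open>Half of the initial minimum, so that the inequality at time 0 is strict.\<close>
  define c where "c = \<kappa> x0 0 / 2"
  have c: "c > 0" using init[of x0] by (simp add: c_def)
  have "\<kappa> x t + - c > 0"
  proof (rule first_zero_max_principle[where f = "\<lambda>x t. \<kappa> x t + - c" and a = 0 and b = t and P = P])
    show "continuous_on (UNIV \<times> {0..t}) (\<lambda>(x, t). \<kappa> x t + - c)"
      by (rule continuous_on_subset[OF smooth_family_continuous[OF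
              smooth_family_add[OF smooth_\<kappa> smooth_family_const]]]) (use t in auto)
    show "\<kappa> (x + P) s + - c = \<kappa> x s + - c" if "s \<in> {0..t}" for x s
      using \<kappa>_periodic[where P = P, OF \<gamma>, of s x] that t by simp
    show "\<kappa> x 0 + - c > 0" for x
    proof -
      obtain y where "y \<in> {0..P}" "\<kappa> y 0 = \<kappa> x 0"
        using periodic_reduce[OF P, of "\<lambda>x. \<kappa> x 0"] \<kappa>_periodic[where P = P, OF \<gamma> T] by blast
      then show ?thesis using x0[of y] init[of x0] by (simp add: c_def)
    qed
    show "\<exists>d>0. ((\<lambda>s. \<kappa> x s + - c) has_real_derivative d) (at s within {0..s})"
      if s: "s \<in> {0<..t}" and zero: "\<kappa> x s + - c = 0" and min: "\<And>y. \<kappa> y s + - c \<ge> 0" for x s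
    proof (intro exI conjI)
      have s': "s \<in> {0..<T}" using s t by auto
      have "D (D \<kappa>) x s \<ge> 0"
        by (rule D_at_spatial_min(2)[OF smooth_\<kappa> s']) (use min zero in \<open>simp add: algebra_simps\<close>)
      moreover have "\<kappa> x s ^ 3 > 0" using zero c by simp
      ultimately show "deriv_t T \<kappa> x s > 0" unfolding deriv_t_\<kappa>[OF s'] by linarith
      have "((\<lambda>s. \<kappa> x s + - c) has_vector_derivative deriv_t T \<kappa> x s) (at s within {0..<T})"
        unfolding has_vector_derivative_add_const
        by (rule smooth_family_has_deriv_t[OF smooth_\<kappa> s'])
      then show "((\<lambda>s. \<kappa> x s + - c) has_real_derivative deriv_t T \<kappa> x s) (at s within {0..s})"
        unfolding has_real_derivative_iff_has_vector_derivative
        by (rule has_vector_derivative_within_subset) (use s t in auto)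
    qed
  qed (use P t in auto)
  then show ?thesis using c by simp
qed

end

section \<open>The Harnack quantity\<close>

locale convex_curve_flow = curve_flow +
  fixes P :: real
  assumes P: "P > 0" and \<gamma>_periodic: "\<And>x t. t \<in> {0..<T} \<Longrightarrow> \<gamma> (x + P) t = \<gamma> x t"
    and \<kappa>_init: "\<And>x. \<kappa> x 0 > 0"
begin

abbreviation u :: "real \<Rightarrow> real \<Rightarrow> real" where
  "u \<equiv> log_curvature \<kappa>"

text \<open>The part of \<open>harnack_h\<close> that is regular at t = 0. By
  \<open>deriv_t_u\<close> it equals u_t - u_s^2, the familiar differential Harnack expression for
  \<kappa>.\<close>

definition F :: "real \<Rightarrow> real \<Rightarrow> real" where
  "F x t = D (D u) x t + exp (2 * u x t)"

lemma exp_u: "t \<in> {0..<T} \<Longrightarrow> exp (u x t) = \<kappa> x t"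
  unfolding log_curvature_def by (rule exp_ln[OF \<kappa>_pos[OF P \<gamma>_periodic \<kappa>_init]])

lemma exp_2u: "t \<in> {0..<T} \<Longrightarrow> exp (2 * u x t) = (\<kappa> x t)\<^sup>2"
  using exp_u[of t x] by (simp only: exp_double)

lemma smooth_u: "smooth_family T u"
  unfolding log_curvature_def
  by (rule smooth_family_ln[OF smooth_\<kappa> \<kappa>_pos[OF P \<gamma>_periodic \<kappa>_init]])

lemma smooth_2u: "smooth_family T (\<lambda>x t. 2 * u x t)"
  by (rule smooth_family_mult[OF smooth_family_const smooth_u])

lemma smooth_F: "smooth_family T F"
  unfolding F_def by (intro smooth_family_add smooth_D smooth_u smooth_family_exp smooth_2u)

lemma F_periodic:
  assumes t: "t \<in> {0..<T}"
  shows "F (x + P) t = F x t"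
proof -
  have u: "u (x + P) t = u x t" if "t \<in> {0..<T}" for x t
    by (simp only: log_curvature_def \<kappa>_periodic[where P = P, OF \<gamma>_periodic that])
  have Du: "D u (x + P) t = D u x t" if "t \<in> {0..<T}" for x t
    by (rule D_periodic[where P = P and f = u, OF \<gamma>_periodic smooth_u u that])
  have "D (D u) (x + P) t = D (D u) x t"
    by (rule D_periodic[where P = P and f = "D u", OF \<gamma>_periodic smooth_D[OF smooth_u] Du t])
  then show ?thesis by (simp only: F_def u[OF t])
qed

lemmas D_times = D_bilinear[OF bounded_bilinear_mult]
lemmas deriv_t_times = deriv_t_bilinear[OF bounded_bilinear_mult]

lemma D_exp_2u: "t \<in> {0..<T} \<Longrightarrow> D (\<lambda>x t. exp (2 * u x t)) x t = 2 * (\<kappa> x t)\<^sup>2 * D u x t"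
  using D_exp[OF smooth_2u, of t x] D_times[OF smooth_family_const smooth_u, of t 2 x]
  by (simp add: exp_2u D_const del: atLeastLessThan_iff)

lemma deriv_t_exp_2u:
  "t \<in> {0..<T} \<Longrightarrow> deriv_t T (\<lambda>x t. exp (2 * u x t)) x t = 2 * (\<kappa> x t)\<^sup>2 * deriv_t T u x t"
  using deriv_t_exp[OF smooth_2u, of t x] deriv_t_times[OF smooth_family_const smooth_u, of t 2 x]
  by (simp add: exp_2u deriv_t_const del: atLeastLessThan_iff)

text \<open>Substituting \<kappa> = e^u gives \<kappa>_ss = \<kappa> (u_ss + u_s^2); dividing the
  evolution equation of \<kappa> by \<kappa> leaves u_ss + u_s^2 + \<kappa>^2. Grouping by
  \<open>F\<close> prepares the next differentiation.\<close>

lemma deriv_t_u: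
  assumes t: "t \<in> {0..<T}"
  shows "deriv_t T u x t = F x t + D u x t * D u x t"
proof -
  note sm = smooth_family_exp[OF smooth_u] smooth_D[OF smooth_u]
  have 1: "D \<kappa> x t = exp (u x t) * D u x t" for x
    using D_exp[OF smooth_u t] D_cong[of "\<lambda>x t. exp (u x t)" t \<kappa>] exp_u[OF t] by simp
  have "D (D \<kappa>) x t = D (\<lambda>x t. exp (u x t) * D u x t) x t"
    by (rule D_cong) (rule 1)
  also have "\<dots> = exp (u x t) * D (D u) x t + exp (u x t) * D u x t * D u x t"
    by (simp add: D_times[OF sm t] D_exp[OF smooth_u t])
  finally have 2: "D (D \<kappa>) x t = \<kappa> x t * (D (D u) x t + D u x t * D u x t)"
    by (simp add: exp_u[OF t] algebra_simps)
  have "deriv_t T \<kappa> x t = deriv_t T (\<lambda>x t. exp (u x t)) x t"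
    by (rule deriv_t_cong[OF t exp_u[symmetric] sm(1)])
  also have "\<dots> = \<kappa> x t * deriv_t T u x t"
    by (simp only: deriv_t_exp[OF smooth_u t] exp_u[OF t])
  finally have "\<kappa> x t * deriv_t T u x t = \<kappa> x t * (D (D u) x t + D u x t * D u x t + (\<kappa> x t)\<^sup>2)"
    by (simp add: deriv_t_\<kappa>[OF t] 2 algebra_simps power2_eq_square power3_eq_cube)
  moreover have "\<kappa> x t \<noteq> 0" using \<kappa>_pos[OF P \<gamma>_periodic \<kappa>_init t, of x] by simp
  ultimately show ?thesis by (simp add: F_def exp_2u[OF t])
qed

text \<open>Two s-derivatives are applied to u_t = F + u_s^2, and each exchange with the time
  derivative contributes a commutator term with factor \<kappa>^2. Adding the time derivative of
  e^(2u) = \<kappa>^2 closes the equation in F.\<close>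

lemma deriv_t_F:
  assumes t: "t \<in> {0..<T}"
  shows "deriv_t T F x t = D (D F) x t + 2 * D u x t * D F x t + 2 * F x t * F x t"
proof -
  note su = smooth_D[OF smooth_u] and suu = smooth_D[OF smooth_D[OF smooth_u]]
    and sF = smooth_D[OF smooth_F]
    and sq = smooth_family_exp[OF smooth_2u]
  have Du_t: "deriv_t T (D u) x t = D F x t + (2 * (D u x t * D (D u) x t) + exp (2 * u x t) * D u x t)"
    if t: "t \<in> {0..<T}" for x t
  proof -
    have "D (deriv_t T u) x t = D (\<lambda>x t. F x t + D u x t * D u x t) x t"
      by (rule D_cong) (rule deriv_t_u[OF t])
    also have "\<dots> = D F x t + 2 * (D u x t * D (D u) x t)"
      by (simp add: D_add[OF smooth_F smooth_family_mult[OF su su] t] D_times[OF su su t])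
    finally show ?thesis
      by (simp add: deriv_t_D[OF smooth_u t] exp_2u[OF t])
  qed
  have "D (deriv_t T (D u)) x t =
      D (\<lambda>x t. D F x t + (2 * (D u x t * D (D u) x t) + exp (2 * u x t) * D u x t)) x t"
    by (rule D_cong) (rule Du_t[OF t])
  also have "\<dots> = D (D F) x t + D (\<lambda>x t. 2 * (D u x t * D (D u) x t) + exp (2 * u x t) * D u x t) x t"
    by (intro D_add sF smooth_family_add smooth_family_mult smooth_family_const su suu sq t)
  also have "D (\<lambda>x t. 2 * (D u x t * D (D u) x t) + exp (2 * u x t) * D u x t) x t =
      D (\<lambda>x t. 2 * (D u x t * D (D u) x t)) x t + D (\<lambda>x t. exp (2 * u x t) * D u x t) x t"
    by (intro D_add smooth_family_mult smooth_family_const su suu sq t)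
  also have "D (\<lambda>x t. 2 * (D u x t * D (D u) x t)) x t =
      2 * (D u x t * D (D (D u)) x t + D (D u) x t * D (D u) x t)"
    using D_times[OF smooth_family_const smooth_family_mult[OF su suu] t, of 2 x] D_times[OF su suu t, of x]
    by (simp add: D_const)
  also have "D (\<lambda>x t. exp (2 * u x t) * D u x t) x t =
      (\<kappa> x t)\<^sup>2 * D (D u) x t + 2 * (\<kappa> x t)\<^sup>2 * D u x t * D u x t"
    by (simp add: D_times[OF sq su t] D_exp_2u[OF t] exp_2u[OF t])
  finally have Duu_t: "deriv_t T (D (D u)) x t = D (D F) x t
      + (2 * (D u x t * D (D (D u)) x t + D (D u) x t * D (D u) x t)
        + ((\<kappa> x t)\<^sup>2 * D (D u) x t + 2 * (\<kappa> x t)\<^sup>2 * D u x t * D u x t))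
      + (\<kappa> x t)\<^sup>2 * D (D u) x t"
    by (simp add: deriv_t_D[OF su t])
  have F_eq: "F = (\<lambda>x t. D (D u) x t + exp (2 * u x t))"
    by (simp add: fun_eq_iff F_def)
  have Fs: "D F x t = D (D (D u)) x t + 2 * (\<kappa> x t)\<^sup>2 * D u x t"
    unfolding F_eq by (simp add: D_add[OF suu sq t] D_exp_2u[OF t])
  have Ft: "deriv_t T F x t = deriv_t T (D (D u)) x t + 2 * (\<kappa> x t)\<^sup>2 * deriv_t T u x t"
    unfolding F_eq by (simp add: deriv_t_add[OF suu sq t] deriv_t_exp_2u[OF t])
  \<comment> \<open>The terms 2 u_s u_sss + 4 \<kappa>^2 u_s^2 form 2 u_s F_s, and the remaining
    zero-order terms form the square 2 (u_ss + \<kappa>^2)^2 = 2 F^2.\<close>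
  show ?thesis
    unfolding Ft Duu_t deriv_t_u[OF t] Fs F_def exp_2u[OF t] by (simp add: algebra_simps)
qed

text \<open>Multiplying \<open>h\<^sub>\<epsilon> = F + c / t\<close> by \<open>t\<close> removes the singularity at \<open>t = 0\<close>, where
  \<open>t F + c\<close> starts out positive. At a first zero \<open>F = - c / t\<close>, so \<open>\<partial>\<^sub>t (t F + c) \<ge> F + 2 t F\<^sup>2 =
  F (1 - 2 c) > 0\<close>.\<close>

lemma harnack_pos:
  assumes c: "c > 1 / 2" and t: "t \<in> {0..<T}"
  shows "t * F x t + c > 0"
proof (rule first_zero_max_principle[where f = "\<lambda>x t. t * F x t + c" and a = 0 and b = t and P = P])
  show "continuous_on (UNIV \<times> {0..t}) (\<lambda>(x, t). t * F x t + c)"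
  proof -
    have "continuous_on (UNIV \<times> {0..t}) (\<lambda>(x, t). F x t)"
      by (rule continuous_on_subset[OF smooth_family_continuous[OF smooth_F]]) (use t in auto)
    then show ?thesis by (auto simp: case_prod_unfold intro!: continuous_intros)
  qed
  show "s * F (x + P) s + c = s * F x s + c" if "s \<in> {0..t}" for x s
    using F_periodic[of s x] that t by simp
  show "\<exists>d>0. ((\<lambda>s. s * F x s + c) has_real_derivative d) (at s within {0..s})"
    if s: "s \<in> {0<..t}" and zero: "s * F x s + c = 0" and min: "\<And>y. s * F y s + c \<ge> 0" for x s
  proof (intro exI conjI)
    have s': "s \<in> {0..<T}" and "s > 0" using s t by auto
    \<comment> \<open>At a fixed time s > 0, the function s F + c has its spatial minima exactly
      where F does.\<close>
    have minF: "F x s \<le> F y s" for y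
    proof -
      have "s * F x s \<le> s * F y s" using zero min[of y] by simp
      then show ?thesis using \<open>s > 0\<close> by simp
    qed
    note sp = D_at_spatial_min[OF smooth_F s' minF]
    have "s * F x s < 0" using zero c by linarith
    then have "F x s < 0" using \<open>s > 0\<close> by (simp add: mult_less_0_iff)
    then have "0 < F x s * (1 - 2 * c)" using c by (simp add: mult_neg_neg)
    also have "c = - (s * F x s)" using zero by simp
    also have "F x s * (1 - 2 * - (s * F x s)) = F x s + s * (2 * F x s * F x s)"
      by (simp add: algebra_simps)
    also have "\<dots> \<le> F x s + s * deriv_t T F x s"
      using sp \<open>s > 0\<close> by (simp add: deriv_t_F[OF s'])
    finally show "0 < F x s + s * deriv_t T F x s" .
    have "(F x has_real_derivative deriv_t T F x s) (at s within {0..<T})"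
      using smooth_family_has_deriv_t[OF smooth_F s']
      by (simp add: has_real_derivative_iff_has_vector_derivative)
    then have "(F x has_real_derivative deriv_t T F x s) (at s within {0..s})"
      by (rule has_field_derivative_subset) (use s t in auto)
    then show "((\<lambda>s. s * F x s + c) has_real_derivative F x s + s * deriv_t T F x s) (at s within {0..s})"
      by (auto intro!: derivative_eq_intros)
  qed
qed (use P c t in auto)

end

theorem theorem1p2:
  fixes T :: real
    and \<gamma> N :: "real \<Rightarrow> real \<Rightarrow> real^2"
    and \<kappa> :: "real \<Rightarrow> real \<Rightarrow> real"
  assumes "closed_embedded_family T \<gamma>"
    and "unit_normal_field T \<gamma> N"
    and "is_curvature T \<gamma> N \<kappa>"
    and "curve_shortening_flow T \<gamma> N \<kappa>"
    and "convex_initial_curve \<gamma> N \<kappa>"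
  shows "\<forall>\<epsilon>>0. \<forall>t\<in>{0<..<T}. \<forall>x. harnack_h \<gamma> \<kappa> \<epsilon> x t \<ge> 0"
proof -
  obtain P where P: "P > 0" "\<And>x t. t \<in> {0..<T} \<Longrightarrow> \<gamma> (x + P) t = \<gamma> x t"
    using assms(1) unfolding closed_embedded_family_def by blast
  interpret convex_curve_flow T \<gamma> N \<kappa> P
  proof
    show "smooth_family T \<gamma>" using assms(1) by (simp add: closed_embedded_family_def)
    show "deriv_x \<gamma> x t \<noteq> 0" if "t \<in> {0..<T}" for x t
      using assms(1) that unfolding closed_embedded_family_def by blast
    show "\<kappa> x 0 > 0" for x using assms(5) by (simp add: convex_initial_curve_def)
  qed (fact assms P)+
  show ?thesis
  proof (intro allI impI ballI)
    fix \<epsilon> t x :: real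
    assume "\<epsilon> > 0" and t: "t \<in> {0<..<T}"
    \<comment> \<open>The positive \<epsilon> provides the strict bound c > 1/2 for c = 1/2 +
      \<epsilon>; with this c, t F + c is t times the quantity sought.\<close>
    then have "t * F x t + (1 / 2 + \<epsilon>) > 0" by (intro harnack_pos) auto
    then have "t * harnack_h \<gamma> \<kappa> \<epsilon> x t \<ge> 0"
      using t by (simp add: harnack_h_def F_def algebra_simps)
    then show "harnack_h \<gamma> \<kappa> \<epsilon> x t \<ge> 0" using t by (simp add: zero_le_mult_iff)
  qed
qed

end
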